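(* Let $B=B_0+B_1$ be a unital alternative non-associative superalgebra and let $Z=Z(B)_0$ be the even part of its center. Assume that the nonzero elements of $Z$ are not zero divisors of $B$, so that $B$ is contained in the localization $Z^{-1}B$, a superalgebra over the field $k=Z^{-1}Z$. If $Z^{-1}B$ is a finite dimensional central simple superalgebra over $k$, then at least one of the following holds: (i) $B$ embeds, as a $Z$-submodule, into a free finitely generated $Z$-module; (ii) $Z^{-1}B$ is isomorphic to a superalgebra of the form $B(\Gamma,\partial,\gamma)$.
   Context: A superalgebra is a $\mathbb{Z}_2$-graded algebra $B=B_0\oplus B_1$. It is alternative if it is an alternative superalgebra in the standard sense, i.e. its Grassmann envelope is an alternative algebra. Write $(x,y,z)=(xy)z-x(yz)$ and $[x,y]=xy-yx$. The center is $Z(B)=\{x\in B\mid (x,a,b)=(a,x,b)=(a,b,x)=[a,x]=0 \ \forall a,b\in B\}$, and $Z(B)_0$ is its even part. A superalgebra $A$ over a field $k$ is central if $Z(A)_0\cong k$. It is simple if its product is nonzero and it has no graded ideals other than $0$ and $A$. $B(\Gamma,\partial,\gamma)$ is defined over a field of characteristic $3$. Let $\Gamma$ be an associative commutative algebra, $\partial$ a derivation of $\Gamma$ such that $\Gamma$ has no nonzero proper $\partial$-invariant ideals, and $\gamma\in\Gamma$. Let $\overline{\Gamma}=\{\overline{x}\mid x\in\Gamma\}$ be a copy of the vector space $\Gamma$. Then $B(\Gamma,\partial,\gamma)=\Gamma\oplus\overline{\Gamma}$ has even part $\Gamma$ and odd part $\overline{\Gamma}$, with multiplication $x\cdot y=xy$,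 $x\cdot\overline{y}=\overline{x}\cdot y=\overline{xy}$, and $\overline{x}\cdot\overline{y}=\gamma xy+2\partial(x)y+x\partial(y)$ for $x,y\in\Gamma$. *)

theory Defs
  imports Main
begin

(* A (super)algebra is modelled as an additive abelian group (a type of class
   ab_group_add, the whole type is the carrier) with an explicit, not necessarily
   associative, biadditive multiplication m, and a Z_2-grading given by two
   additive subgroups S0 (even part) and S1 (odd part). *)

definition sassoc :: "('a::ab_group_add \<Rightarrow> 'a \<Rightarrow> 'a) \<Rightarrow> 'a \<Rightarrow> 'a \<Rightarrow> 'a \<Rightarrow> 'a" where
  "sassoc m x y z = m (m x y) z - m x (m y z)"

definition scomm :: "('a::ab_group_add \<Rightarrow> 'a \<Rightarrow> 'a) \<Rightarrow> 'a \<Rightarrow> 'a \<Rightarrow> 'a" where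
  "scomm m x y = m x y - m y x"

definition add_subgroup :: "'a::ab_group_add set \<Rightarrow> bool" where
  "add_subgroup S \<longleftrightarrow> 0 \<in> S \<and> (\<forall>x\<in>S. \<forall>y\<in>S. x + y \<in> S) \<and> (\<forall>x\<in>S. - x \<in> S)"

definition superalgebra :: "('a::ab_group_add \<Rightarrow> 'a \<Rightarrow> 'a) \<Rightarrow> 'a set \<Rightarrow> 'a set \<Rightarrow> bool" where
  "superalgebra m S0 S1 \<longleftrightarrow>
     (\<forall>x y z. m (x + y) z = m x z + m y z \<and> m x (y + z) = m x y + m x z) \<and>
     add_subgroup S0 \<and> add_subgroup S1 \<and> S0 \<inter> S1 = {0} \<and>
     (\<forall>x. \<exists>a\<in>S0. \<exists>b\<in>S1. x = a + b) \<and>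
     (\<forall>x\<in>S0. \<forall>y\<in>S0. m x y \<in> S0) \<and> (\<forall>x\<in>S0. \<forall>y\<in>S1. m x y \<in> S1) \<and>
     (\<forall>x\<in>S1. \<forall>y\<in>S0. m x y \<in> S1) \<and> (\<forall>x\<in>S1. \<forall>y\<in>S1. m x y \<in> S0)"

(* Alternative superalgebra: the Grassmann envelope is alternative. Written out on
   homogeneous elements: the associator is graded skew-symmetric in the first two and
   in the last two arguments, and (x,x,y) = (y,x,x) = 0 for even x
   (the latter is implied by the former when 2 is invertible). *)
definition alternative_superalgebra :: "('a::ab_group_add \<Rightarrow> 'a \<Rightarrow> 'a) \<Rightarrow> 'a set \<Rightarrow> 'a set \<Rightarrow> bool" where
  "alternative_superalgebra m S0 S1 \<longleftrightarrow> superalgebra m S0 S1 \<and>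
     (\<forall>x\<in>S0 \<union> S1. \<forall>y\<in>S0 \<union> S1. \<forall>z\<in>S0 \<union> S1.
        sassoc m x y z = (if x \<in> S1 \<and> y \<in> S1 then sassoc m y x z else - sassoc m y x z) \<and>
        sassoc m x y z = (if y \<in> S1 \<and> z \<in> S1 then sassoc m x z y else - sassoc m x z y)) \<and>
     (\<forall>x\<in>S0. \<forall>y. sassoc m x x y = 0 \<and> sassoc m y x x = 0)"

definition center :: "('a::ab_group_add \<Rightarrow> 'a \<Rightarrow> 'a) \<Rightarrow> 'a set" where
  "center m = {x. \<forall>a b. sassoc m x a b = 0 \<and> sassoc m a x b = 0 \<and> sassoc m a b x = 0 \<and> scomm m a x = 0}"

definition unital :: "('a::ab_group_add \<Rightarrow> 'a \<Rightarrow> 'a) \<Rightarrow> bool" where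
  "unital m \<longleftrightarrow> (\<exists>e. \<forall>x. m e x = x \<and> m x e = x)"

definition unit_of :: "('a::ab_group_add \<Rightarrow> 'a \<Rightarrow> 'a) \<Rightarrow> 'a" where
  "unit_of m = (THE e. \<forall>x. m e x = x \<and> m x e = x)"

definition associative :: "('a::ab_group_add \<Rightarrow> 'a \<Rightarrow> 'a) \<Rightarrow> bool" where
  "associative m \<longleftrightarrow> (\<forall>x y z. sassoc m x y z = 0)"

definition graded_ideal :: "('a::ab_group_add \<Rightarrow> 'a \<Rightarrow> 'a) \<Rightarrow> 'a set \<Rightarrow> 'a set \<Rightarrow> 'a set \<Rightarrow> bool" where
  "graded_ideal m S0 S1 I \<longleftrightarrow> add_subgroup I \<and> (\<forall>x\<in>I. \<forall>a. m a x \<in> I \<and> m x a \<in> I) \<and>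
     (\<forall>x\<in>I. \<exists>u\<in>I \<inter> S0. \<exists>v\<in>I \<inter> S1. x = u + v)"

definition simple_superalgebra :: "('a::ab_group_add \<Rightarrow> 'a \<Rightarrow> 'a) \<Rightarrow> 'a set \<Rightarrow> 'a set \<Rightarrow> bool" where
  "simple_superalgebra m S0 S1 \<longleftrightarrow> superalgebra m S0 S1 \<and> (\<exists>x y. m x y \<noteq> 0) \<and>
     (\<forall>I. graded_ideal m S0 S1 I \<longrightarrow> I = {0} \<or> I = UNIV)"

(* (mA, A0, A1) together with phi is (up to isomorphism) the localization Z^{-1}B,
   Z = Z(B)_0: phi is an injective homomorphism of superalgebras, elements of Z go to
   central elements, nonzero elements of Z become invertible with even central inverse,
   and every element of A has the form phi(z)^{-1} phi(b). *)
definition is_localization ::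
  "('b::ab_group_add \<Rightarrow> 'b \<Rightarrow> 'b) \<Rightarrow> 'b set \<Rightarrow> 'b set \<Rightarrow>
   ('a::ab_group_add \<Rightarrow> 'a \<Rightarrow> 'a) \<Rightarrow> 'a set \<Rightarrow> 'a set \<Rightarrow> ('b \<Rightarrow> 'a) \<Rightarrow> bool" where
  "is_localization mB B0 B1 mA A0 A1 \<phi> \<longleftrightarrow>
     superalgebra mA A0 A1 \<and> inj \<phi> \<and>
     (\<forall>x y. \<phi> (x + y) = \<phi> x + \<phi> y \<and> \<phi> (mB x y) = mA (\<phi> x) (\<phi> y)) \<and>
     \<phi> ` B0 \<subseteq> A0 \<and> \<phi> ` B1 \<subseteq> A1 \<and>
     (\<forall>z\<in>center mB \<inter> B0. \<phi> z \<in> center mA) \<and>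
     (\<forall>z\<in>center mB \<inter> B0 - {0}. \<exists>w\<in>center mA \<inter> A0.
         \<forall>x. mA (mA (\<phi> z) w) x = x \<and> mA x (mA (\<phi> z) w) = x) \<and>
     (\<forall>a. \<exists>z\<in>center mB \<inter> B0 - {0}. \<exists>b. mA (\<phi> z) a = \<phi> b)"

definition loc_scalars ::
  "('b::ab_group_add \<Rightarrow> 'b \<Rightarrow> 'b) \<Rightarrow> 'b set \<Rightarrow> ('a::ab_group_add \<Rightarrow> 'a \<Rightarrow> 'a) \<Rightarrow> ('b \<Rightarrow> 'a) \<Rightarrow> 'a set" where
  "loc_scalars mB B0 mA \<phi> =
     {a. \<exists>z\<in>center mB \<inter> B0 - {0}. \<exists>z'\<in>center mB \<inter> B0. mA (\<phi> z) a = \<phi> z'}"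

definition finite_dim_over :: "('a::ab_group_add \<Rightarrow> 'a \<Rightarrow> 'a) \<Rightarrow> 'a set \<Rightarrow> bool" where
  "finite_dim_over mA K \<longleftrightarrow>
     (\<exists>S. finite S \<and> (\<forall>a. \<exists>c. (\<forall>s\<in>S. c s \<in> K) \<and> a = (\<Sum>s\<in>S. mA (c s) s)))"

definition embeds_in_free_fg_module :: "('b::ab_group_add \<Rightarrow> 'b \<Rightarrow> 'b) \<Rightarrow> 'b set \<Rightarrow> bool" where
  "embeds_in_free_fg_module mB B0 \<longleftrightarrow>
     (\<exists>(n::nat) (f::'b \<Rightarrow> nat \<Rightarrow> 'b). inj f \<and>
        (\<forall>b i. f b i \<in> center mB \<inter> B0) \<and> (\<forall>b i. n \<le> i \<longrightarrow> f b i = 0) \<and>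
        (\<forall>b b' i. f (b + b') i = f b i + f b' i) \<and>
        (\<forall>z\<in>center mB \<inter> B0. \<forall>b i. f (mB z b) i = mB z (f b i)))"

(* Multiplication of B(Gamma, D, gamma) = Gamma + bar Gamma, an element (x,u)
   standing for x + bar u *)
definition BG_mult ::
  "('g \<Rightarrow> 'g \<Rightarrow> 'g) \<Rightarrow> ('g \<Rightarrow> 'g \<Rightarrow> 'g) \<Rightarrow> ('g \<Rightarrow> 'g) \<Rightarrow> 'g \<Rightarrow> 'g \<times> 'g \<Rightarrow> 'g \<times> 'g \<Rightarrow> 'g \<times> 'g" where
  "BG_mult addG mulG D \<gamma> p q =
     (case p of (x, u) \<Rightarrow> case q of (y, v) \<Rightarrow>
       (addG (mulG x y)
          (addG (mulG \<gamma> (mulG u v))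
             (addG (addG (mulG (D u) v) (mulG (D u) v)) (mulG u (D v)))),
        addG (mulG x v) (mulG u y)))"

definition Gamma_data ::
  "('a::ab_group_add \<Rightarrow> 'a \<Rightarrow> 'a) \<Rightarrow> 'a set \<Rightarrow> 'a \<Rightarrow>
   'g set \<Rightarrow> ('g \<Rightarrow> 'g \<Rightarrow> 'g) \<Rightarrow> 'g \<Rightarrow> ('g \<Rightarrow> 'g \<Rightarrow> 'g) \<Rightarrow> ('a \<Rightarrow> 'g \<Rightarrow> 'g) \<Rightarrow>
   ('g \<Rightarrow> 'g) \<Rightarrow> 'g \<Rightarrow> bool" where
  "Gamma_data mA K eK G addG zG mulG smul D \<gamma> \<longleftrightarrow>
     zG \<in> G \<and> \<gamma> \<in> G \<and>
     (\<forall>x\<in>G. \<forall>y\<in>G. addG x y \<in> G \<and> mulG x y \<in> G) \<and>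
     (\<forall>l\<in>K. \<forall>x\<in>G. smul l x \<in> G) \<and> D ` G \<subseteq> G \<and>
     (\<forall>x\<in>G. \<forall>y\<in>G. \<forall>z\<in>G. addG (addG x y) z = addG x (addG y z)) \<and>
     (\<forall>x\<in>G. \<forall>y\<in>G. addG x y = addG y x) \<and>
     (\<forall>x\<in>G. addG zG x = x) \<and>
     (\<forall>x\<in>G. \<exists>y\<in>G. addG x y = zG) \<and>
     (\<forall>x\<in>G. \<forall>y\<in>G. \<forall>z\<in>G. mulG (mulG x y) z = mulG x (mulG y z)) \<and>
     (\<forall>x\<in>G. \<forall>y\<in>G. mulG x y = mulG y x) \<and>
     (\<forall>x\<in>G. \<forall>y\<in>G. \<forall>z\<in>G. mulG x (addG y z) = addG (mulG x y) (mulG x z)) \<and>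
     (\<forall>l\<in>K. \<forall>l'\<in>K. \<forall>x\<in>G. smul (l + l') x = addG (smul l x) (smul l' x)) \<and>
     (\<forall>l\<in>K. \<forall>l'\<in>K. \<forall>x\<in>G. smul (mA l l') x = smul l (smul l' x)) \<and>
     (\<forall>x\<in>G. smul eK x = x) \<and>
     (\<forall>l\<in>K. \<forall>x\<in>G. \<forall>y\<in>G. smul l (addG x y) = addG (smul l x) (smul l y)) \<and>
     (\<forall>l\<in>K. \<forall>x\<in>G. \<forall>y\<in>G. mulG (smul l x) y = smul l (mulG x y) \<and>
                             mulG x (smul l y) = smul l (mulG x y)) \<and>
     (\<forall>x\<in>G. \<forall>y\<in>G. D (addG x y) = addG (D x) (D y)) \<and>
     (\<forall>l\<in>K. \<forall>x\<in>G. D (smul l x) = smul l (D x)) \<and>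
     (\<forall>x\<in>G. \<forall>y\<in>G. D (mulG x y) = addG (mulG (D x) y) (mulG x (D y))) \<and>
     (\<forall>I. I \<subseteq> G \<and> zG \<in> I \<and> (\<forall>x\<in>I. \<forall>y\<in>I. addG x y \<in> I) \<and>
          (\<forall>l\<in>K. \<forall>x\<in>I. smul l x \<in> I) \<and> (\<forall>x\<in>G. \<forall>y\<in>I. mulG x y \<in> I) \<and>
          D ` I \<subseteq> I \<longrightarrow> I = {zG} \<or> I = G)"

definition BG_iso ::
  "('a::ab_group_add \<Rightarrow> 'a \<Rightarrow> 'a) \<Rightarrow> 'a set \<Rightarrow> 'a set \<Rightarrow> 'a set \<Rightarrow>
   'g set \<Rightarrow> ('g \<Rightarrow> 'g \<Rightarrow> 'g) \<Rightarrow> 'g \<Rightarrow> ('g \<Rightarrow> 'g \<Rightarrow> 'g) \<Rightarrow> ('a \<Rightarrow> 'g \<Rightarrow> 'g) \<Rightarrow>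
   ('g \<Rightarrow> 'g) \<Rightarrow> 'g \<Rightarrow> ('a \<Rightarrow> 'g \<times> 'g) \<Rightarrow> bool" where
  "BG_iso mA A0 A1 K G addG zG mulG smul D \<gamma> \<psi> \<longleftrightarrow>
     bij_betw \<psi> UNIV (G \<times> G) \<and>
     (\<forall>a b. \<psi> (a + b) = (addG (fst (\<psi> a)) (fst (\<psi> b)), addG (snd (\<psi> a)) (snd (\<psi> b)))) \<and>
     (\<forall>a b. \<psi> (mA a b) = BG_mult addG mulG D \<gamma> (\<psi> a) (\<psi> b)) \<and>
     (\<forall>l\<in>K. \<forall>a. \<psi> (mA l a) = (smul l (fst (\<psi> a)), smul l (snd (\<psi> a)))) \<and>
     \<psi> ` A0 = G \<times> {zG} \<and> \<psi> ` A1 = {zG} \<times> G"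

(* A is isomorphic, as a superalgebra over the field K (of characteristic 3), to some
   B(Gamma, D, gamma).  The carrier of Gamma is taken inside the type of A, which is
   no loss of generality since Gamma is in bijection with the even part A0. *)
definition iso_to_B_Gamma :: "('a::ab_group_add \<Rightarrow> 'a \<Rightarrow> 'a) \<Rightarrow> 'a set \<Rightarrow> 'a set \<Rightarrow> 'a set \<Rightarrow> bool" where
  "iso_to_B_Gamma mA A0 A1 K \<longleftrightarrow>
     unit_of mA + unit_of mA + unit_of mA = 0 \<and>
     (\<exists>(G::'a set) addG zG mulG smul D \<gamma> \<psi>.
        Gamma_data mA K (unit_of mA) G addG zG mulG smul D \<gamma> \<and>
        BG_iso mA A0 A1 K G addG zG mulG smul D \<gamma> \<psi>)"

end

theory Submission
  imports Defs
begin

text \<open>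
  Alternative (i) always holds. Let \<open>M\<close> be the ring of operators on \<open>A = Z\<^sup>-\<^sup>1B\<close> generated by the
  left and right multiplications and the projection onto the even part. The \<open>M\<close>-submodules of \<open>A\<close>
  are the graded ideals, so \<open>A\<close> is an irreducible \<open>M\<close>-module, and its \<open>M\<close>-endomorphisms are the
  multiplications by elements of \<open>Z(A)\<^sub>0 = k\<close>. By the Jacobson density argument \<open>M\<close> contains the
  coordinate functionals \<open>A \<rightarrow> k\<close> of a \<open>k\<close>-basis of \<open>A\<close>. Each operator in \<open>M\<close> involves finitely many
  elements of \<open>A\<close>, so multiplied by a suitable nonzero element of \<open>Z\<close> it maps \<open>B\<close> to \<open>B\<close>; the scaled
  coordinate functionals then map \<open>B\<close> to \<open>B \<inter> k = Z\<close> and jointly separate the points of \<open>B\<close>.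
\<close>

section \<open>Central elements and the even part of a superalgebra\<close>

lemma center_iff:
  "z \<in> center m \<longleftrightarrow> (\<forall>a b. m a z = m z a \<and> m (m z a) b = m z (m a b) \<and> m a (m z b) = m z (m a b))"
proof
  assume z: "z \<in> center m"
  \<comment> \<open>The commutator and the associators with \<open>z\<close> in first and middle
    place suffice to move \<open>z\<close> to the left end of every product, the normal form used
    throughout.\<close>
  have "m a z = m z a" "m (m z a) b = m z (m a b)" "m (m a z) b = m a (m z b)" for a b
    using z unfolding center_def sassoc_def scomm_def right_minus_eq mem_Collect_eq by blast+
  then show "\<forall>a b. m a z = m z a \<and> m (m z a) b = m z (m a b) \<and> m a (m z b) = m z (m a b)"
    by metis
next
  assume "\<forall>a b. m a z = m z a \<and> m (m z a) b = m z (m a b) \<and> m a (m z b) = m z (m a b)"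
  then show "z \<in> center m"
    unfolding center_def sassoc_def scomm_def by simp
qed

lemma center_mult:
  assumes "x \<in> center m" "y \<in> center m"
  shows "m x y \<in> center m"
  using assms unfolding center_iff by metis

locale superalg =
  fixes m :: "'a::ab_group_add \<Rightarrow> 'a \<Rightarrow> 'a" and S0 S1 :: "'a set"
  assumes superalgebra: "superalgebra m S0 S1"
begin

lemma distrib: "m (x + y) z = m x z + m y z" "m x (y + z) = m x y + m x z"
  using superalgebra unfolding superalgebra_def by auto

lemma mult_0: "m 0 x = 0" "m x 0 = 0"
  using distrib(1)[of 0 0 x] distrib(2)[of x 0 0] by auto

lemma mult_minus: "m (- x) y = - m x y" "m x (- y) = - m x y"
  using distrib(1)[of x "- x" y] distrib(2)[of x y "- y"]
  by (simp_all add: mult_0 eq_neg_iff_add_eq_0 add.commute)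

lemma mult_sum: "m x (\<Sum>s\<in>S. f s) = (\<Sum>s\<in>S. m x (f s))"
  by (induction S rule: infinite_finite_induct) (auto simp: mult_0 distrib)

lemma add_subgroup_parts: "add_subgroup S0" "add_subgroup S1"
  using superalgebra unfolding superalgebra_def by auto

lemma diff_closed:
  "x \<in> S0 \<Longrightarrow> y \<in> S0 \<Longrightarrow> x - y \<in> S0"
  "x \<in> S1 \<Longrightarrow> y \<in> S1 \<Longrightarrow> x - y \<in> S1"
  using add_subgroup_parts unfolding add_subgroup_def by (metis add_uminus_conv_diff)+

lemma add_closed:
  "x \<in> S0 \<Longrightarrow> y \<in> S0 \<Longrightarrow> x + y \<in> S0"
  "x \<in> S1 \<Longrightarrow> y \<in> S1 \<Longrightarrow> x + y \<in> S1"
  and zero_closed: "0 \<in> S0" "0 \<in> S1"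
  using add_subgroup_parts unfolding add_subgroup_def by auto

lemma decomp: "\<exists>a\<in>S0. \<exists>b\<in>S1. x = a + b"
  using superalgebra unfolding superalgebra_def by auto

lemma parts_disjoint: "x \<in> S0 \<Longrightarrow> x \<in> S1 \<Longrightarrow> x = 0"
  using superalgebra unfolding superalgebra_def by auto

lemma even_mult: "x \<in> S0 \<Longrightarrow> y \<in> S0 \<Longrightarrow> m x y \<in> S0"
  "x \<in> S0 \<Longrightarrow> y \<in> S1 \<Longrightarrow> m x y \<in> S1"
  using superalgebra unfolding superalgebra_def by auto

definition even_part :: "'a \<Rightarrow> 'a" where
  "even_part x = (THE a. a \<in> S0 \<and> x - a \<in> S1)"

text \<open>Two candidates differ by an element that is both even and odd, hence zero. Later facts
  about the projection follow by exhibiting a candidate.\<close>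

lemma even_part_eqI:
  assumes "a \<in> S0" "x - a \<in> S1"
  shows "even_part x = a"
  unfolding even_part_def
proof (rule the_equality)
  fix b assume b: "b \<in> S0 \<and> x - b \<in> S1"
  have "b - a \<in> S0" using b assms diff_closed by blast
  moreover have "(x - a) - (x - b) \<in> S1" using b assms diff_closed by blast
  then have "b - a \<in> S1" by simp
  ultimately show "b = a" using parts_disjoint by fastforce
qed (use assms in auto)

lemma even_part: "even_part x \<in> S0" "x - even_part x \<in> S1"
proof -
  obtain a b where "a \<in> S0" "b \<in> S1" "x = a + b" using decomp by blast
  then have "a \<in> S0 \<and> x - a \<in> S1" by simp
  then have "even_part x = a" "a \<in> S0" "x - a \<in> S1" using even_part_eqI by auto
  then show "even_part x \<in> S0" "x - even_part x \<in> S1" by simp_all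
qed

lemma even_part_add: "even_part (x + y) = even_part x + even_part y"
proof (rule even_part_eqI)
  have "(x - even_part x) + (y - even_part y) \<in> S1"
    by (intro add_closed even_part)
  then show "x + y - (even_part x + even_part y) \<in> S1" by (simp add: algebra_simps)
qed (intro add_closed even_part)

lemma even_part_mult:
  assumes "l \<in> S0"
  shows "even_part (m l x) = m l (even_part x)"
proof (rule even_part_eqI)
  have "m l (x - even_part x) \<in> S1" using assms even_mult even_part by blast
  moreover have "m l (x - even_part x) = m l x - m l (even_part x)"
    using distrib(2)[of l x "- even_part x"] by (simp add: mult_minus)
  ultimately show "m l x - m l (even_part x) \<in> S1" by simp
qed (use assms even_mult even_part in blast)

section \<open>Even central scalars, the operator ring and spans\<close>

definition K :: "'a set" where
  "K = center m \<inter> S0"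

lemma K_mult: "x \<in> K \<Longrightarrow> y \<in> K \<Longrightarrow> m x y \<in> K"
  unfolding K_def using center_mult even_mult by blast

lemma K_add: "x \<in> K \<Longrightarrow> y \<in> K \<Longrightarrow> x + y \<in> K"
  unfolding K_def using add_closed by (auto simp: center_iff distrib)

lemma K_zero: "0 \<in> K"
  unfolding K_def using zero_closed by (auto simp: center_iff mult_0)

lemma K_commutes:
  assumes "l \<in> K"
  shows "m a l = m l a" "m (m l a) b = m l (m a b)" "m a (m l b) = m l (m a b)"
  using assms unfolding K_def Int_iff center_iff by auto

text \<open>The generator \<open>even\<close> turns submodules into graded ideals. Zero is left
  multiplication by \<open>0\<close>; when there is a unit, the identity and negation are left
  multiplications too.\<close>

inductive_set mult_ring :: "('a \<Rightarrow> 'a) set" where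
  left: "(\<lambda>x. m a x) \<in> mult_ring"
| right: "(\<lambda>x. m x a) \<in> mult_ring"
| even: "even_part \<in> mult_ring"
| add: "S \<in> mult_ring \<Longrightarrow> T \<in> mult_ring \<Longrightarrow> (\<lambda>x. S x + T x) \<in> mult_ring"
| comp: "S \<in> mult_ring \<Longrightarrow> T \<in> mult_ring \<Longrightarrow> (\<lambda>x. S (T x)) \<in> mult_ring"

lemma mult_ring_add:
  assumes "T \<in> mult_ring"
  shows "T (x + y) = T x + T y"
  using assms by (induction arbitrary: x y) (simp_all add: distrib even_part_add algebra_simps)

lemma mult_ring_zero: "T \<in> mult_ring \<Longrightarrow> T 0 = 0"
  using mult_ring_add[of T 0 0] by simp

lemma mult_ring_minus: "T \<in> mult_ring \<Longrightarrow> T (- x) = - T x"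
  using mult_ring_add[of T "- x" x] mult_ring_zero[of T] by (simp add: eq_neg_iff_add_eq_0)

text \<open>Scalars commute with left and right multiplications because they are central, and with
  \<open>even_part\<close> because they are even. So every operator is linear over
  \<open>K\<close>.\<close>

lemma mult_ring_scale:
  assumes "T \<in> mult_ring" "l \<in> K"
  shows "T (m l x) = m l (T x)"
  using assms(1)
proof (induction arbitrary: x)
  case even
  show ?case using assms(2) even_part_mult by (simp add: K_def)
qed (simp_all add: distrib K_commutes[OF assms(2)])

lemma mult_ring_sum:
  assumes "T \<in> mult_ring"
  shows "T (\<Sum>s\<in>S. f s) = (\<Sum>s\<in>S. T (f s))"
  by (induction S rule: infinite_finite_induct)
    (simp_all add: mult_ring_zero mult_ring_add assms)

text \<open>The formula repeats that of \<open>finite_dim_over\<close>, so finite dimension says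
  that \<open>kspan S = UNIV\<close> for some finite \<open>S\<close>.\<close>

definition kspan :: "'a set \<Rightarrow> 'a set" where
  "kspan S = {x. \<exists>c. (\<forall>s\<in>S. c s \<in> K) \<and> x = (\<Sum>s\<in>S. m (c s) s)}"

lemma kspan_insert:
  assumes "finite S" "w \<notin> S" "x \<in> kspan S" "l \<in> K"
  shows "x + m l w \<in> kspan (insert w S)"
proof -
  obtain c where c: "\<forall>s\<in>S. c s \<in> K" "x = (\<Sum>s\<in>S. m (c s) s)"
    using assms(3) unfolding kspan_def by blast
  have "(\<Sum>s\<in>S. m ((c(w := l)) s) s) = (\<Sum>s\<in>S. m (c s) s)"
    by (rule sum.cong) (use assms(2) in auto)
  then have "x + m l w = (\<Sum>s\<in>insert w S. m ((c(w := l)) s) s)"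
    using assms c by (simp add: add.commute)
  moreover have "\<forall>s\<in>insert w S. (c(w := l)) s \<in> K" using c assms by auto
  ultimately show ?thesis unfolding kspan_def by blast
qed

lemma kspan_mono_insert:
  assumes "finite S" "x \<in> kspan S"
  shows "x \<in> kspan (insert w S)"
  using kspan_insert[OF assms(1) _ assms(2) K_zero, of w] assms
  by (cases "w \<in> S") (auto simp: insert_absorb mult_0)

text \<open>Substituting the expression for \<open>s\<close> into a combination over
  \<open>S\<close> eliminates \<open>s\<close>. This thins a finite spanning set down to a
  basis.\<close>

lemma kspan_remove:
  assumes "finite S" "s \<in> S" "s \<in> kspan (S - {s})" "x \<in> kspan S"
  shows "x \<in> kspan (S - {s})"
proof -
  obtain d where d: "\<forall>t\<in>S - {s}. d t \<in> K" "s = (\<Sum>t\<in>S - {s}. m (d t) t)"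
    using assms(3) unfolding kspan_def by blast
  obtain c where c: "\<forall>t\<in>S. c t \<in> K" "x = (\<Sum>t\<in>S. m (c t) t)"
    using assms(4) unfolding kspan_def by blast
  have cs: "c s \<in> K" using c assms by blast
  have "x = (\<Sum>t\<in>S - {s}. m (c t) t) + m (c s) s"
    using c assms by (simp add: sum.remove add.commute)
  also have "m (c s) s = (\<Sum>t\<in>S - {s}. m (c s) (m (d t) t))"
    using arg_cong[OF d(2), of "m (c s)"] by (simp only: mult_sum)
  also have "\<dots> = (\<Sum>t\<in>S - {s}. m (m (c s) (d t)) t)"
    by (simp add: K_commutes[OF cs])
  finally have "x = (\<Sum>t\<in>S - {s}. m (c t + m (c s) (d t)) t)"
    by (simp add: distrib sum.distrib)
  moreover have "\<forall>t\<in>S - {s}. c t + m (c s) (d t) \<in> K"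
    using c d cs K_add K_mult by auto
  ultimately show ?thesis
    unfolding kspan_def by (intro CollectI exI[of _ "\<lambda>t. c t + m (c s) (d t)"]) auto
qed

lemma mult_ring_vanishes_kspan:
  assumes "T \<in> mult_ring" "\<forall>s\<in>S. T s = 0" "x \<in> kspan S"
  shows "T x = 0"
proof -
  obtain c where c: "\<forall>s\<in>S. c s \<in> K" "x = (\<Sum>s\<in>S. m (c s) s)"
    using assms(3) unfolding kspan_def by blast
  show ?thesis unfolding c(2) mult_ring_sum[OF assms(1)]
    by (rule sum.neutral) (use c assms in \<open>auto simp: mult_ring_scale mult_0\<close>)
qed

end

section \<open>Irreducibility, Schur's lemma and Jacobson density\<close>

locale simple_unital_superalg = superalg +
  fixes u :: 'a
  assumes simple: "simple_superalgebra m S0 S1"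
    and unit: "m u x = x" "m x u = x"
    and unit_even: "u \<in> S0"
begin

lemma id_mult_ring: "(\<lambda>x. x) \<in> mult_ring"
proof -
  have "m u = (\<lambda>x. x)" by (rule ext) (simp add: unit)
  then show ?thesis using mult_ring.left[of u] by simp
qed

lemma minus_mult_ring: "T \<in> mult_ring \<Longrightarrow> (\<lambda>x. - T x) \<in> mult_ring"
  using mult_ring.comp[OF mult_ring.left[of "- u"]] by (simp add: unit mult_minus)

text \<open>Closure under multiplications makes \<open>I\<close> an ideal and closure under
  \<open>even_part\<close> makes it graded, so simplicity applies.\<close>

lemma irreducible:
  assumes "add_subgroup I" "\<And>T x. T \<in> mult_ring \<Longrightarrow> x \<in> I \<Longrightarrow> T x \<in> I" "w \<in> I" "w \<noteq> 0"
  shows "I = UNIV"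
proof -
  have "graded_ideal m S0 S1 I"
    unfolding graded_ideal_def
  proof (intro conjI ballI allI)
    fix x a assume x: "x \<in> I"
    show "m a x \<in> I" "m x a \<in> I"
      using assms(2)[OF mult_ring.left x] assms(2)[OF mult_ring.right x] by auto
  next
    fix x assume x: "x \<in> I"
    have e: "even_part x \<in> I" using assms(2)[OF mult_ring.even x] .
    then have "x - even_part x \<in> I"
      using x assms(1) unfolding add_subgroup_def by (metis add_uminus_conv_diff)
    then show "\<exists>u\<in>I \<inter> S0. \<exists>v\<in>I \<inter> S1. x = u + v"
      using e even_part[of x]
      by (intro bexI[of _ "even_part x"] bexI[of _ "x - even_part x"]) auto
  qed (use assms in auto)
  then show ?thesis using simple assms(3,4) unfolding simple_superalgebra_def by blast
qed

text \<open>A form of Schur's lemma: commuting with right and left multiplications makes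
  \<open>c\<close> both left and right multiplication by \<open>c u\<close>, which is therefore
  central. Commuting with \<open>even_part\<close> makes \<open>c u\<close> even, since
  \<open>u\<close> is.\<close>

lemma mult_ring_endo_scalar:
  assumes "\<And>T x. T \<in> mult_ring \<Longrightarrow> c (T x) = T (c x)"
  shows "\<exists>l\<in>K. \<forall>x. c x = m l x"
proof -
  have cL: "c (m a x) = m a (c x)" and cR: "c (m x a) = m (c x) a" for a x
    using assms[OF mult_ring.left] assms[OF mult_ring.right] by auto
  have l: "c x = m (c u) x" "c x = m x (c u)" for x
    using cR[of u x] cL[of x u] by (simp_all add: unit)
  have "even_part u = u"
    using even_part_eqI[of u u] unit_even zero_closed by simp
  then have "c u \<in> S0"
    using assms[OF mult_ring.even, of u] even_part(1)[of "c u"] by simp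
  moreover have "c u \<in> center m"
    unfolding center_iff using l cL cR by metis
  ultimately show ?thesis using l unfolding K_def by blast
qed

text \<open>Induction on \<open>S\<close>. If the operators killing \<open>S\<close> and
  \<open>w\<close> all killed \<open>v\<close>, then \<open>v\<close> would agree with a scalar
  multiple of \<open>w\<close> modulo the span of \<open>S\<close>.\<close>

lemma density:
  assumes "finite S" "v \<notin> kspan S"
  shows "\<exists>T\<in>mult_ring. (\<forall>s\<in>S. T s = 0) \<and> T v \<noteq> 0"
  using assms
proof (induction S arbitrary: v rule: finite_induct)
  case empty
  then have "v \<noteq> 0" by (auto simp: kspan_def)
  then show ?case using id_mult_ring by (intro bexI[of _ "\<lambda>x. x"]) auto
next
  case (insert w S)
  show ?case
  proof (cases "w \<in> kspan S")
    case True
    have "v \<notin> kspan S" using insert kspan_mono_insert by blast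
    then obtain T where "T \<in> mult_ring" "\<forall>s\<in>S. T s = 0" "T v \<noteq> 0"
      using insert.IH by blast
    then show ?thesis using mult_ring_vanishes_kspan True by (metis insert_iff)
  next
    case False
    define J where "J = {T \<in> mult_ring. \<forall>s\<in>S. T s = 0}"
    have J_add: "(\<lambda>x. P x + Q x) \<in> J" if "P \<in> J" "Q \<in> J" for P Q
      using that mult_ring.add unfolding J_def by auto
    have J_minus: "(\<lambda>x. - P x) \<in> J" if "P \<in> J" for P
      using that minus_mult_ring unfolding J_def by auto
    have J_comp: "(\<lambda>x. T (P x)) \<in> J" if "T \<in> mult_ring" "P \<in> J" for T P
      using that mult_ring.comp mult_ring_zero unfolding J_def by auto
    obtain T0 where T0: "T0 \<in> J" "T0 w \<noteq> 0"
      using insert.IH[OF False] unfolding J_def by blast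
    \<comment> \<open>\<open>J\<close> is a left ideal of operators, so its values at
      \<open>w\<close> form a submodule, nonzero because of \<open>T0\<close>.\<close>
    have Jw: "(\<lambda>T. T w) ` J = UNIV"
    proof (rule irreducible)
      show "add_subgroup ((\<lambda>T. T w) ` J)"
        unfolding add_subgroup_def
      proof (intro conjI ballI)
        have "(\<lambda>x. T0 x + - T0 x) \<in> J" using T0 J_add J_minus by blast
        then show "0 \<in> (\<lambda>T. T w) ` J" by (rule rev_image_eqI) simp
      qed (use J_add J_minus in \<open>auto intro: rev_image_eqI\<close>)
      show "T x \<in> (\<lambda>T. T w) ` J" if "T \<in> mult_ring" "x \<in> (\<lambda>T. T w) ` J" for T x
        using that J_comp by (auto intro: rev_image_eqI)
    qed (use T0 in auto)
    show ?thesis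
    proof (rule ccontr)
      assume "\<not> ?thesis"
      then have vanish: "T v = 0" if "T \<in> J" "T w = 0" for T
        using that unfolding J_def by auto
      have well_def: "P v = Q v" if "P \<in> J" "Q \<in> J" "P w = Q w" for P Q
        using vanish[OF J_add[OF that(1) J_minus[OF that(2)]]] that(3) by simp
      \<comment> \<open>The map \<open>P w\<close> to \<open>P v\<close> for \<open>P\<close> in
        \<open>J\<close>: defined everywhere by \<open>Jw\<close>, independent of the chosen
        operator by \<open>well_def\<close>. It commutes with \<open>mult_ring\<close>, hence is a
        scalar.\<close>
      define c where "c x = (SOME T. T \<in> J \<and> T w = x) v" for x
      have c: "c (P w) = P v" if "P \<in> J" for P
      proof -
        have "(SOME T. T \<in> J \<and> T w = P w) \<in> J \<and> (SOME T. T \<in> J \<and> T w = P w) w = P w"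
          by (rule someI[of _ P]) (use that in auto)
        then show ?thesis unfolding c_def using well_def that by blast
      qed
      have "c (T x) = T (c x)" if "T \<in> mult_ring" for T x
      proof -
        obtain P where P: "P \<in> J" "x = P w" using Jw by blast
        show ?thesis using c[OF J_comp[OF that P(1)]] c[OF P(1)] P(2) by simp
      qed
      then obtain l where l: "l \<in> K" "\<And>x. c x = m l x"
        using mult_ring_endo_scalar by blast
      \<comment> \<open>Every \<open>T\<close> in \<open>J\<close> satisfies
        \<open>T v = c (T w) = m l (T w)\<close>, so it kills \<open>v - m l w\<close>. The
        induction hypothesis for this vector excludes that it lies outside the span.\<close>
      have "v - m l w \<in> kspan S"
      proof (rule ccontr)
        assume "v - m l w \<notin> kspan S"
        then obtain T where T: "T \<in> mult_ring" "\<forall>s\<in>S. T s = 0" "T (v - m l w) \<noteq> 0"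
          using insert.IH by blast
        have "T (v - m l w) = T v - m l (T w)"
          using mult_ring_add[OF T(1), of v "- m l w"] T(1) l(1)
          by (simp add: mult_ring_minus mult_ring_scale)
        also have "\<dots> = 0" using c[of T] l T unfolding J_def by auto
        finally show False using T by simp
      qed
      then have "v \<in> kspan (insert w S)"
        using kspan_insert[OF insert.hyps(1,2) _ l(1), of "v - m l w"] by simp
      then show False using insert.prems by blast
    qed
  qed
qed

text \<open>After discarding dependent elements, density isolates each basis element from the
  others, and irreducibility normalizes the value there to \<open>u\<close>.\<close>

lemma coordinate_functionals:
  assumes "finite S" "kspan S = UNIV"
  shows "\<exists>S' P. finite S' \<and> (\<forall>s\<in>S'. P s \<in> mult_ring \<and> (\<forall>x. P s x \<in> K)) \<and>
           (\<forall>x. x = (\<Sum>s\<in>S'. m (P s x) s))"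
  using assms
proof (induction "card S" arbitrary: S rule: less_induct)
  case less
  show ?case
  proof (cases "\<exists>s\<in>S. s \<in> kspan (S - {s})")
    case True
    then obtain s where s: "s \<in> S" "s \<in> kspan (S - {s})" by blast
    have "kspan (S - {s}) = UNIV" using kspan_remove s less.prems by blast
    then show ?thesis
      using less.hyps[OF card_Diff1_less[OF less.prems(1) s(1)]] less.prems(1) by blast
  next
    case False
    have "\<exists>T\<in>mult_ring. (\<forall>t\<in>S - {s}. T t = 0) \<and> T s = u" if s: "s \<in> S" for s
    proof -
      obtain T where T: "T \<in> mult_ring" "\<forall>t\<in>S - {s}. T t = 0" "T s \<noteq> 0"
        using density[of "S - {s}" s] False s less.prems by auto
      \<comment> \<open>The nonzero vector \<open>T s\<close> generates the whole module, so some
        \<open>Q\<close> carries it to the unit while \<open>Q\<close> after \<open>T\<close> still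
        kills the rest of \<open>S\<close>.\<close>
      have "(\<lambda>Q. Q (T s)) ` mult_ring = UNIV"
      proof (rule irreducible)
        show "add_subgroup ((\<lambda>Q. Q (T s)) ` mult_ring)"
          unfolding add_subgroup_def
        proof (intro conjI ballI)
          show "0 \<in> (\<lambda>Q. Q (T s)) ` mult_ring"
            using mult_ring.left[of 0] by (rule rev_image_eqI) (simp add: mult_0)
        qed (use mult_ring.add minus_mult_ring in \<open>auto intro: rev_image_eqI\<close>)
        show "Q x \<in> (\<lambda>Q. Q (T s)) ` mult_ring"
          if "Q \<in> mult_ring" "x \<in> (\<lambda>Q. Q (T s)) ` mult_ring" for Q x
          using that mult_ring.comp by (auto intro: rev_image_eqI)
        show "T s \<in> (\<lambda>Q. Q (T s)) ` mult_ring"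
          using id_mult_ring by (rule rev_image_eqI) simp
      qed (use T in auto)
      then obtain Q where Q: "Q \<in> mult_ring" "Q (T s) = u" by (metis UNIV_I imageE)
      show ?thesis
        using mult_ring.comp[OF Q(1) T(1)] T Q
        by (intro bexI[of _ "\<lambda>x. Q (T x)"]) (auto simp: mult_ring_zero)
    qed
    then obtain P where P: "\<And>s. s \<in> S \<Longrightarrow> P s \<in> mult_ring"
      "\<And>s t. s \<in> S \<Longrightarrow> t \<in> S - {s} \<Longrightarrow> P s t = 0" "\<And>s. s \<in> S \<Longrightarrow> P s s = u"
      by metis
    \<comment> \<open>By linearity only the term at \<open>s\<close> survives, and it equals
      \<open>c s\<close> times \<open>u\<close>. Hence \<open>P s\<close> reads off a coefficient
      and takes values in \<open>K\<close>.\<close>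
    have coord: "P s (\<Sum>t\<in>S. m (c t) t) = c s" if s: "s \<in> S" and c: "\<forall>t\<in>S. c t \<in> K" for s c
    proof -
      have "P s (\<Sum>t\<in>S. m (c t) t) = (\<Sum>t\<in>S. P s (m (c t) t))"
        using P(1) s by (simp add: mult_ring_sum)
      also have "\<dots> = (\<Sum>t\<in>S. if t = s then c s else 0)"
        by (rule sum.cong) (use P s c in \<open>auto simp: mult_ring_scale unit mult_0\<close>)
      also have "\<dots> = c s" using s less.prems by simp
      finally show ?thesis .
    qed
    have "(\<forall>s\<in>S. P s x \<in> K) \<and> x = (\<Sum>s\<in>S. m (P s x) s)" for x
    proof -
      have "x \<in> kspan S" using less.prems by simp
      then obtain c where c: "\<forall>t\<in>S. c t \<in> K" "x = (\<Sum>t\<in>S. m (c t) t)"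
        unfolding kspan_def by blast
      have "P s x = c s" if "s \<in> S" for s using coord[OF that c(1)] c(2) by simp
      then show ?thesis using c by simp
    qed
    then show ?thesis using P(1) less.prems(1) by blast
  qed
qed

end

section \<open>Localization and descent of functionals to \<open>B\<close>\<close>

locale localized_superalg =
  B: superalg mB B0 B1 + A: superalg mA A0 A1
  for mB :: "'b::ab_group_add \<Rightarrow> 'b \<Rightarrow> 'b" and B0 B1
    and mA :: "'a::ab_group_add \<Rightarrow> 'a \<Rightarrow> 'a" and A0 A1 +
  fixes \<phi> :: "'b \<Rightarrow> 'a"
  assumes localization: "is_localization mB B0 B1 mA A0 A1 \<phi>"
begin

lemma hom: "\<phi> (x + y) = \<phi> x + \<phi> y" "\<phi> (mB x y) = mA (\<phi> x) (\<phi> y)"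
  and \<phi>_eq: "\<phi> x = \<phi> y \<longleftrightarrow> x = y"
  and \<phi>_even: "x \<in> B0 \<Longrightarrow> \<phi> x \<in> A0"
  and \<phi>_odd: "x \<in> B1 \<Longrightarrow> \<phi> x \<in> A1"
  using localization unfolding is_localization_def inj_def by auto

lemma \<phi>_zero: "\<phi> 0 = 0"
  using hom(1)[of 0 0] by simp

lemma \<phi>_scalar: "z \<in> B.K \<Longrightarrow> \<phi> z \<in> A.K"
  using localization \<phi>_even unfolding is_localization_def B.K_def A.K_def by auto

lemma scalar_inverse:
  assumes "z \<in> B.K" "z \<noteq> 0"
  shows "\<exists>w\<in>A.K. \<forall>x. mA (mA (\<phi> z) w) x = x \<and> mA x (mA (\<phi> z) w) = x"
  using assms localization unfolding is_localization_def B.K_def A.K_def by auto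

lemma denominator: "\<exists>z\<in>B.K. z \<noteq> 0 \<and> (\<exists>b. mA (\<phi> z) a = \<phi> b)"
  using localization unfolding is_localization_def B.K_def by blast

lemma scalar_cancel:
  assumes "z \<in> B.K" "z \<noteq> 0" "mA (\<phi> z) x = mA (\<phi> z) y"
  shows "x = y"
proof -
  obtain w where w: "w \<in> A.K" "\<And>x. mA (mA (\<phi> z) w) x = x"
    using scalar_inverse assms by blast
  have "x = mA w (mA (\<phi> z) x)" for x
    using w(2)[of x] A.K_commutes[OF w(1)] by metis
  then show ?thesis using assms(3) by metis
qed

lemma scalar_mult_nonzero:
  assumes "z \<in> B.K" "z \<noteq> 0" "y \<noteq> 0"
  shows "mB z y \<noteq> 0"
proof
  assume "mB z y = 0"
  then have "mA (\<phi> z) (\<phi> y) = mA (\<phi> z) 0" using hom(2)[of z y] by (simp add: \<phi>_zero A.mult_0)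
  then show False using scalar_cancel assms \<phi>_zero \<phi>_eq by metis
qed

text \<open>The identities defining the center pull back along the injective \<open>\<phi>\<close>.
  The odd component of \<open>b\<close> has an image both even and odd, so it vanishes.\<close>

lemma scalar_reflect:
  assumes "\<phi> b \<in> A.K"
  shows "b \<in> B.K"
proof -
  have "mB a b = mB b a" "mB (mB b a) c = mB b (mB a c)" "mB a (mB b c) = mB b (mB a c)" for a c
    using A.K_commutes(1)[OF assms, of "\<phi> a"] A.K_commutes(2,3)[OF assms, of "\<phi> a" "\<phi> c"]
    unfolding hom(2)[symmetric] \<phi>_eq by auto
  then have "b \<in> center mB" unfolding center_iff by blast
  moreover obtain b0 b1 where b: "b0 \<in> B0" "b1 \<in> B1" "b = b0 + b1" using B.decomp by blast
  have "\<phi> b - \<phi> b0 \<in> A0"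
    using assms b \<phi>_even A.diff_closed unfolding A.K_def by blast
  then have "\<phi> b1 \<in> A0" using b(3) by (simp add: hom)
  then have "\<phi> b1 = \<phi> 0" using A.parts_disjoint \<phi>_odd[OF b(2)] \<phi>_zero by auto
  then have "b \<in> B0" using b by (simp add: \<phi>_eq)
  ultimately show ?thesis unfolding B.K_def by blast
qed

text \<open>One \<open>z\<close> serves all \<open>b\<close>, since an operator is built from
  finitely many elements of the localization. Denominators multiply under sums and compositions and
  stay nonzero by \<open>scalar_mult_nonzero\<close>.\<close>

lemma clear_denominators:
  assumes "T \<in> A.mult_ring"
  shows "\<exists>z\<in>B.K. z \<noteq> 0 \<and> (\<forall>b. \<exists>b'. \<phi> b' = mA (\<phi> z) (T (\<phi> b)))"
  using assms
proof induction
  case (left a)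
  obtain z b0 where z: "z \<in> B.K" "z \<noteq> 0" "mA (\<phi> z) a = \<phi> b0" using denominator by blast
  have "\<phi> (mB b0 b) = mA (\<phi> z) (mA a (\<phi> b))" for b
    using A.K_commutes[OF \<phi>_scalar[OF z(1)]] z(3) hom(2) by metis
  then show ?case using z by blast
next
  case (right a)
  obtain z b0 where z: "z \<in> B.K" "z \<noteq> 0" "mA (\<phi> z) a = \<phi> b0" using denominator by blast
  have "\<phi> (mB b b0) = mA (\<phi> z) (mA (\<phi> b) a)" for b
    using A.K_commutes[OF \<phi>_scalar[OF z(1)]] z(3) hom(2) by metis
  then show ?case using z by blast
next
  case even
  obtain z where z: "z \<in> B.K" "z \<noteq> 0" using denominator by blast
  \<comment> \<open>The homomorphism respects the gradings, so the projection already preserves the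
    image of \<open>B\<close> and any nonzero \<open>z\<close> will do.\<close>
  have "A.even_part (\<phi> b) = \<phi> (B.even_part b)" for b
  proof (rule A.even_part_eqI)
    have "\<phi> b = \<phi> (B.even_part b) + \<phi> (b - B.even_part b)"
      using hom(1)[of "B.even_part b" "b - B.even_part b"] by simp
    then show "\<phi> b - \<phi> (B.even_part b) \<in> A1"
      using \<phi>_odd[OF B.even_part(2)[of b]] by simp
  qed (use \<phi>_even B.even_part in blast)
  then have "\<phi> (mB z (B.even_part b)) = mA (\<phi> z) (A.even_part (\<phi> b))" for b
    by (simp add: hom)
  then show ?case using z by blast
next
  case (add S T)
  obtain y where y: "y \<in> B.K" "y \<noteq> 0" "\<And>b. \<exists>b'. \<phi> b' = mA (\<phi> y) (S (\<phi> b))"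
    using add.IH(1) by blast
  obtain z where z: "z \<in> B.K" "z \<noteq> 0" "\<And>b. \<exists>b'. \<phi> b' = mA (\<phi> z) (T (\<phi> b))"
    using add.IH(2) by blast
  have "\<exists>b'. \<phi> b' = mA (\<phi> (mB y z)) (S (\<phi> b) + T (\<phi> b))" for b
  proof -
    obtain s t where s: "\<phi> s = mA (\<phi> y) (S (\<phi> b))" and t: "\<phi> t = mA (\<phi> z) (T (\<phi> b))"
      using y(3) z(3) by blast
    have "mA (\<phi> (mB y z)) x = mA (\<phi> y) (mA (\<phi> z) x)"
      "mA (\<phi> (mB y z)) x = mA (\<phi> z) (mA (\<phi> y) x)" for x
      using A.K_commutes[OF \<phi>_scalar[OF y(1)]] hom(2) by metis+
    then have "\<phi> (mB z s + mB y t) = mA (\<phi> (mB y z)) (S (\<phi> b) + T (\<phi> b))"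
      by (simp add: A.distrib(2) hom(1) hom(2)[of z s] hom(2)[of y t] s t)
    then show ?thesis by blast
  qed
  then show ?case using B.K_mult[OF y(1) z(1)] scalar_mult_nonzero[OF y(1,2) z(2)] by blast
next
  case (comp S T)
  obtain y where y: "y \<in> B.K" "y \<noteq> 0" "\<And>b. \<exists>b'. \<phi> b' = mA (\<phi> y) (S (\<phi> b))"
    using comp.IH(1) by blast
  obtain z where z: "z \<in> B.K" "z \<noteq> 0" "\<And>b. \<exists>b'. \<phi> b' = mA (\<phi> z) (T (\<phi> b))"
    using comp.IH(2) by blast
  have "\<exists>b'. \<phi> b' = mA (\<phi> (mB y z)) (S (T (\<phi> b)))" for b
  proof -
    obtain t where t: "\<phi> t = mA (\<phi> z) (T (\<phi> b))" using z(3) by blast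
    obtain s where s: "\<phi> s = mA (\<phi> y) (S (\<phi> t))" using y(3) by blast
    \<comment> \<open>Linearity of \<open>S\<close> over \<open>A.K\<close> pulls the denominator of
      \<open>T\<close> out in front.\<close>
    have "\<phi> s = mA (\<phi> y) (mA (\<phi> z) (S (T (\<phi> b))))"
      using s t A.mult_ring_scale[OF comp.hyps(1) \<phi>_scalar[OF z(1)]] by simp
    also have "\<dots> = mA (\<phi> (mB y z)) (S (T (\<phi> b)))"
      using A.K_commutes[OF \<phi>_scalar[OF y(1)]] hom(2) by metis
    finally show ?thesis by blast
  qed
  then show ?case using B.K_mult[OF y(1) z(1)] scalar_mult_nonzero[OF y(1,2) z(2)] by blast
qed

text \<open>\<open>F\<close> is \<open>P\<close> times a common denominator \<open>y\<close>. Its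
  values lie in the image of \<open>B\<close> and in \<open>A.K\<close>, hence come from
  \<open>B.K\<close> by \<open>scalar_reflect\<close>. As \<open>y\<close> cancels, \<open>F\<close>
  separates whatever \<open>P\<close> separates.\<close>

lemma descend_functional:
  assumes P: "P \<in> A.mult_ring" "\<And>x. P x \<in> A.K"
  shows "\<exists>F. (\<forall>b. F b \<in> B.K) \<and> (\<forall>b b'. F (b + b') = F b + F b') \<and>
           (\<forall>z\<in>B.K. \<forall>b. F (mB z b) = mB z (F b)) \<and>
           (\<forall>b b'. F b = F b' \<longrightarrow> P (\<phi> b) = P (\<phi> b'))"
proof -
  obtain y F where y: "y \<in> B.K" "y \<noteq> 0" and F: "\<And>b. \<phi> (F b) = mA (\<phi> y) (P (\<phi> b))"
    using clear_denominators[OF P(1)] by metis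
  have "F b \<in> B.K" for b
    by (rule scalar_reflect) (simp add: F A.K_mult \<phi>_scalar y P)
  moreover have "F (b + b') = F b + F b'" for b b'
    unfolding \<phi>_eq[symmetric] by (simp add: hom F A.mult_ring_add[OF P(1)] A.distrib)
  moreover have "F (mB z b) = mB z (F b)" if z: "z \<in> B.K" for z b
    unfolding \<phi>_eq[symmetric]
    by (simp add: hom F A.mult_ring_scale[OF P(1) \<phi>_scalar[OF z]] A.K_commutes(3)[OF \<phi>_scalar[OF z]])
  moreover have "P (\<phi> b) = P (\<phi> b')" if "F b = F b'" for b b'
    using that F scalar_cancel[OF y] by metis
  ultimately show ?thesis by blast
qed

lemma embeds:
  assumes simple: "simple_superalgebra mA A0 A1" and fd: "finite_dim_over mA A.K"
  shows "embeds_in_free_fg_module mB B0"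
proof -
  obtain z where z: "z \<in> B.K" "z \<noteq> 0" using denominator by blast
  obtain w where w: "w \<in> A.K" "\<And>x. mA (mA (\<phi> z) w) x = x" "\<And>x. mA x (mA (\<phi> z) w) = x"
    using scalar_inverse[OF z] by blast
  \<comment> \<open>A nonzero scalar times its inverse serves as the unit; it is even as a product
    of even scalars.\<close>
  interpret A: simple_unital_superalg mA A0 A1 "mA (\<phi> z) w"
  proof
    show "mA (\<phi> z) w \<in> A0" using A.K_mult[OF \<phi>_scalar[OF z(1)] w(1)] by (simp add: A.K_def)
  qed (use simple w in auto)
  obtain S where "finite S" "A.kspan S = UNIV"
    using fd unfolding finite_dim_over_def A.kspan_def by blast
  from A.coordinate_functionals[OF this] obtain S P
    where SP: "finite S \<and> (\<forall>s\<in>S. P s \<in> A.mult_ring \<and> (\<forall>x. P s x \<in> A.K)) \<and>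
           (\<forall>x. x = (\<Sum>s\<in>S. mA (P s x) s))"
    by (elim exE)
  then have S: "finite S" and P: "\<And>s. s \<in> S \<Longrightarrow> P s \<in> A.mult_ring"
    "\<And>s x. s \<in> S \<Longrightarrow> P s x \<in> A.K" by auto
  have expand: "x = (\<Sum>s\<in>S. mA (P s x) s)" for x
    using SP by (elim conjE allE)
  define good where "good s F \<longleftrightarrow> (\<forall>b. F b \<in> B.K) \<and> (\<forall>b b'. F (b + b') = F b + F b') \<and>
           (\<forall>z\<in>B.K. \<forall>b. F (mB z b) = mB z (F b)) \<and>
           (\<forall>b b'. F b = F b' \<longrightarrow> P s (\<phi> b) = P s (\<phi> b'))" for s F
  have "\<forall>s\<in>S. \<exists>F. good s F"
    unfolding good_def using P descend_functional by blast
  then obtain F where good: "\<forall>s\<in>S. good s (F s)" by (rule bchoice[THEN exE])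
  have F: "F s b \<in> B.K" "F s (b + b') = F s b + F s b'"
    "z \<in> B.K \<Longrightarrow> F s (mB z b) = mB z (F s b)"
    "F s b = F s b' \<Longrightarrow> P s (\<phi> b) = P s (\<phi> b')" if "s \<in> S" for s z b b'
    using good that unfolding good_def by blast+
  obtain xs where xs: "set xs = S" using S finite_list by blast
  then have nth: "xs ! i \<in> S" if "i < length xs" for i using that nth_mem by blast
  \<comment> \<open>A list enumerating \<open>S\<close> turns the functionals into coordinates
    indexed by naturals, padded with \<open>0\<close> from \<open>length xs\<close> on.\<close>
  define f where "f b i = (if i < length xs then F (xs ! i) b else 0)" for b i
  have "inj f"
  proof (rule injI)
    fix b b' assume eq: "f b = f b'"
    have "P s (\<phi> b) = P s (\<phi> b')" if "s \<in> S" for s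
    proof -
      obtain i where "i < length xs" "s = xs ! i" using \<open>s \<in> S\<close> xs by (metis in_set_conv_nth)
      then have "F s b = F s b'" using fun_cong[OF eq, of i] by (simp add: f_def)
      then show ?thesis using F(4) that by blast
    qed
    \<comment> \<open>Equal coordinates give equal expansions over \<open>S\<close>, and these
      recover \<open>\<phi> b\<close> and \<open>\<phi> b'\<close>.\<close>
    then have "(\<Sum>s\<in>S. mA (P s (\<phi> b)) s) = (\<Sum>s\<in>S. mA (P s (\<phi> b')) s)" by simp
    then have "\<phi> b = \<phi> b'" by (simp only: expand[symmetric])
    then show "b = b'" by (simp add: \<phi>_eq)
  qed
  moreover have "f b i \<in> center mB \<inter> B0" for b i
    unfolding B.K_def[symmetric] f_def using F(1) nth B.K_zero by simp
  moreover have "f (b + b') i = f b i + f b' i" for b b' i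
    unfolding f_def using F(2) nth by simp
  moreover have "f (mB z b) i = mB z (f b i)" if "z \<in> center mB \<inter> B0" for z b i
    using that F(3) nth unfolding f_def B.K_def[symmetric] by (simp add: B.mult_0)
  moreover have "\<forall>b i. length xs \<le> i \<longrightarrow> f b i = 0" by (simp add: f_def)
  ultimately show ?thesis unfolding embeds_in_free_fg_module_def by blast
qed

end

theorem theorem2:
  fixes mB :: "'b::ab_group_add \<Rightarrow> 'b \<Rightarrow> 'b" and B0 B1 :: "'b set"
    and mA :: "'a::ab_group_add \<Rightarrow> 'a \<Rightarrow> 'a" and A0 A1 :: "'a set"
    and \<phi> :: "'b \<Rightarrow> 'a"
  assumes alt: "alternative_superalgebra mB B0 B1"
    and unit: "unital mB"
    and nonassoc: "\<not> associative mB"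
    and nzd: "\<forall>z\<in>center mB \<inter> B0. z \<noteq> 0 \<longrightarrow> (\<forall>b. b \<noteq> 0 \<longrightarrow> mB z b \<noteq> 0 \<and> mB b z \<noteq> 0)"
    and loc: "is_localization mB B0 B1 mA A0 A1 \<phi>"
    and fd: "finite_dim_over mA (loc_scalars mB B0 mA \<phi>)"
    and central: "center mA \<inter> A0 = loc_scalars mB B0 mA \<phi>"
    and simple: "simple_superalgebra mA A0 A1"
  shows "embeds_in_free_fg_module mB B0 \<or>
         iso_to_B_Gamma mA A0 A1 (loc_scalars mB B0 mA \<phi>)"
proof -
  interpret localized_superalg mB B0 B1 mA A0 A1 \<phi>
    using alt simple loc
    by unfold_locales (auto simp: alternative_superalgebra_def simple_superalgebra_def)
  \<comment> \<open>Centrality identifies \<open>loc_scalars\<close> with \<open>A.K\<close>, so the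
    dimension hypothesis is about the scalars of \<open>embeds\<close>, which yields the first
    alternative.\<close>
  show ?thesis using embeds[OF simple] fd unfolding A.K_def central by blast
qed

end
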